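(* Let $n$ be a positive integer, let $R=(M_{ij})_{i,j\in\mathbb{I}_n}$ be an $n$-by-$n$ generalized matrix ring with diagonal rings $R_i=M_{ii}$, and let $\mathcal{I}=\{I_j\subset R_j : I_j \text{ is an ideal of } R_j,\ j\in\mathbb{I}_n\}$ be a finite family of ideals. For $j,k\in\mathbb{I}_n$ put $I_{jk}:=I_jM_{jk}+M_{jk}I_k\subset M_{jk}$, and let $I:=(I_{jk})_{j,k\in\mathbb{I}_n}\subset R$ be the set of all arrays in $R$ whose $(j,k)$ entry belongs to $I_{jk}$ for all $j,k\in\mathbb{I}_n$. If $R$ is $\mathcal{I}$-symmetric, then $I$ is an ideal of $R$.
   Context: Rings are associative. $\mathbb{I}_n=\{1,\dots,n\}$. An $n$-by-$n$ generalized matrix ring $R=(M_{ij})_{i,j\in\mathbb{I}_n}$ is given by rings $R_1,\dots,R_n$, $(R_i,R_j)$-bimodules $M_{ij}$ with $M_{ii}=R_i$, and bimodule morphisms $\theta_{ijk}:M_{ij}\otimes_{R_j}M_{jk}\to M_{ik}$; one writes $m_{ij}m_{jk}:=\theta_{ijk}(m_{ij}\otimes m_{jk})$ and requires $(m_{ij}m_{jk})m_{kl}=m_{ij}(m_{jk}m_{kl})$ for all $i,j,k,l\in\mathbb{I}_n$. Here $\theta_{iii}$ is the multiplication of $R_i$, and $\theta_{ijj},\theta_{jjk}$ are given by the bimodule structures. Elements of $R$ are square arrays $(m_{ij})$ with $m_{ij}\in M_{ij}$; addition is componentwise and multiplication is row-column matrix multiplication. Products such as $I_jM_{jk}$ denote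 the additive subgroup (submodule) generated by all products of elements. "Ideal" means two-sided ideal. $M_{ij}$ is called $\mathcal{I}$-symmetric if $I_iM_{ij}=M_{ij}I_j$; $R$ is called $\mathcal{I}$-symmetric if $M_{ij}$ is $\mathcal{I}$-symmetric for all $i,j\in\mathbb{I}_n$. *)

theory Defs
  imports "HOL-Algebra.Ideal" "HOL-Algebra.Free_Abelian_Groups"
begin

section \<open>Rings without a required unit\<close>

text \<open>
  Rings are only assumed to be associative. The locale \<^locale>\<open>ring\<close> of the library demands a
  unit, so non-unital rings and their ideals are introduced here. They live on the same
  record type \<open>'a ring\<close>; its field \<^const>\<open>one\<close> carries no information.
\<close>

locale nonunital_ring = abelian_group R for R (structure) +
  assumes mult_closed: "\<lbrakk>x \<in> carrier R; y \<in> carrier R\<rbrakk> \<Longrightarrow> x \<otimes> y \<in> carrier R"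
    and mult_assoc: "\<lbrakk>x \<in> carrier R; y \<in> carrier R; z \<in> carrier R\<rbrakk> \<Longrightarrow>
      (x \<otimes> y) \<otimes> z = x \<otimes> (y \<otimes> z)"
    and distrib_right: "\<lbrakk>x \<in> carrier R; y \<in> carrier R; z \<in> carrier R\<rbrakk> \<Longrightarrow>
      (x \<oplus> y) \<otimes> z = x \<otimes> z \<oplus> y \<otimes> z"
    and distrib_left: "\<lbrakk>x \<in> carrier R; y \<in> carrier R; z \<in> carrier R\<rbrakk> \<Longrightarrow>
      z \<otimes> (x \<oplus> y) = z \<otimes> x \<oplus> z \<otimes> y"

locale nonunital_ideal = additive_subgroup I R + nonunital_ring R for I and R (structure) +
  assumes ideal_l_closed: "\<lbrakk>a \<in> I; x \<in> carrier R\<rbrakk> \<Longrightarrow> x \<otimes> a \<in> I"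
    and ideal_r_closed: "\<lbrakk>a \<in> I; x \<in> carrier R\<rbrakk> \<Longrightarrow> a \<otimes> x \<in> I"

lemma (in ring) nonunital_ring: "nonunital_ring R"
  by unfold_locales (auto simp: m_assoc l_distr r_distr)

lemma (in ring) nonunital_ideal_iff_ideal: "nonunital_ideal I R \<longleftrightarrow> ideal I R"
proof
  assume "nonunital_ideal I R"
  then interpret J: nonunital_ideal I R .
  show "ideal I R"
    by (intro ideal.intro ideal_axioms.intro J.is_additive_subgroup ring_axioms
        J.ideal_l_closed J.ideal_r_closed)
next
  assume "ideal I R"
  then interpret J: ideal I R .
  show "nonunital_ideal I R"
    by (intro nonunital_ideal.intro nonunital_ideal_axioms.intro J.is_additive_subgroup
        nonunital_ring J.I_l_closed J.I_r_closed)
qed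


section \<open>Bimodules and their morphisms\<close>

text \<open>
  As for the library's record of modules, the additive group is stored in a ring record
  whose multiplication and unit are irrelevant.
\<close>

record ('r, 's, 'a) bimodule = "'a ring" +
  lsmult :: "'r \<Rightarrow> 'a \<Rightarrow> 'a"
  rsmult :: "'a \<Rightarrow> 's \<Rightarrow> 'a"

locale bimodule = R: nonunital_ring R + S: nonunital_ring S + M: abelian_group M
  for R :: "('r, 'm) ring_scheme" and S :: "('s, 'n) ring_scheme"
    and M :: "('r, 's, 'a, 'p) bimodule_scheme" +
  assumes lsmult_closed:
      "\<lbrakk>r \<in> carrier R; x \<in> carrier M\<rbrakk> \<Longrightarrow> lsmult M r x \<in> carrier M"
    and lsmult_add_left:
      "\<lbrakk>r \<in> carrier R; r' \<in> carrier R; x \<in> carrier M\<rbrakk> \<Longrightarrow>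
        lsmult M (r \<oplus>\<^bsub>R\<^esub> r') x = lsmult M r x \<oplus>\<^bsub>M\<^esub> lsmult M r' x"
    and lsmult_add_right:
      "\<lbrakk>r \<in> carrier R; x \<in> carrier M; y \<in> carrier M\<rbrakk> \<Longrightarrow>
        lsmult M r (x \<oplus>\<^bsub>M\<^esub> y) = lsmult M r x \<oplus>\<^bsub>M\<^esub> lsmult M r y"
    and lsmult_assoc:
      "\<lbrakk>r \<in> carrier R; r' \<in> carrier R; x \<in> carrier M\<rbrakk> \<Longrightarrow>
        lsmult M (r \<otimes>\<^bsub>R\<^esub> r') x = lsmult M r (lsmult M r' x)"
    and rsmult_closed:
      "\<lbrakk>x \<in> carrier M; s \<in> carrier S\<rbrakk> \<Longrightarrow> rsmult M x s \<in> carrier M"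
    and rsmult_add_right:
      "\<lbrakk>x \<in> carrier M; s \<in> carrier S; s' \<in> carrier S\<rbrakk> \<Longrightarrow>
        rsmult M x (s \<oplus>\<^bsub>S\<^esub> s') = rsmult M x s \<oplus>\<^bsub>M\<^esub> rsmult M x s'"
    and rsmult_add_left:
      "\<lbrakk>x \<in> carrier M; y \<in> carrier M; s \<in> carrier S\<rbrakk> \<Longrightarrow>
        rsmult M (x \<oplus>\<^bsub>M\<^esub> y) s = rsmult M x s \<oplus>\<^bsub>M\<^esub> rsmult M y s"
    and rsmult_assoc:
      "\<lbrakk>x \<in> carrier M; s \<in> carrier S; s' \<in> carrier S\<rbrakk> \<Longrightarrow>
        rsmult M x (s \<otimes>\<^bsub>S\<^esub> s') = rsmult M (rsmult M x s) s'"
    and lsmult_rsmult: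
      "\<lbrakk>r \<in> carrier R; x \<in> carrier M; s \<in> carrier S\<rbrakk> \<Longrightarrow>
        rsmult M (lsmult M r x) s = lsmult M r (rsmult M x s)"

definition regular_bimodule :: "('a, 'm) ring_scheme \<Rightarrow> ('a, 'a, 'a) bimodule" where
  "regular_bimodule R =
    \<lparr>carrier = carrier R, monoid.mult = monoid.mult R, one = \<one>\<^bsub>R\<^esub>,
     ring.zero = \<zero>\<^bsub>R\<^esub>, ring.add = (\<oplus>\<^bsub>R\<^esub>), lsmult = monoid.mult R, rsmult = monoid.mult R\<rparr>"

definition bimodule_hom ::
  "('r, 'm) ring_scheme \<Rightarrow> ('s, 'n) ring_scheme \<Rightarrow> ('r, 's, 'a, 'p) bimodule_scheme \<Rightarrow>
   ('r, 's, 'b, 'q) bimodule_scheme \<Rightarrow> ('a \<Rightarrow> 'b) set" where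
  "bimodule_hom R S M N =
    {f \<in> hom (add_monoid M) (add_monoid N).
      (\<forall>r\<in>carrier R. \<forall>x\<in>carrier M. f (lsmult M r x) = lsmult N r (f x)) \<and>
      (\<forall>x\<in>carrier M. \<forall>s\<in>carrier S. f (rsmult M x s) = rsmult N (f x) s)}"


section \<open>Tensor products\<close>

text \<open>
  The tensor product over \<open>S\<close> of a right \<open>S\<close>-module \<open>M\<close> and a left \<open>S\<close>-module \<open>N\<close> is the free
  abelian group on \<open>M \<times> N\<close> modulo the relations of biadditivity and \<open>S\<close>-balancedness;
  its elements are cosets.
\<close>

definition tensor_relations ::
  "('s, 'n) ring_scheme \<Rightarrow> ('r, 's, 'a, 'p) bimodule_scheme \<Rightarrow> ('s, 't, 'b, 'q) bimodule_scheme \<Rightarrow>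
   ('a \<times> 'b \<Rightarrow>\<^sub>0 int) set" where
  "tensor_relations S M N = generate (free_Abelian_group (carrier M \<times> carrier N))
    ({frag_of (x \<oplus>\<^bsub>M\<^esub> x', y) - frag_of (x, y) - frag_of (x', y) | x x' y.
        x \<in> carrier M \<and> x' \<in> carrier M \<and> y \<in> carrier N} \<union>
     {frag_of (x, y \<oplus>\<^bsub>N\<^esub> y') - frag_of (x, y) - frag_of (x, y') | x y y'.
        x \<in> carrier M \<and> y \<in> carrier N \<and> y' \<in> carrier N} \<union>
     {frag_of (rsmult M x s, y) - frag_of (x, lsmult N s y) | x s y.
        x \<in> carrier M \<and> s \<in> carrier S \<and> y \<in> carrier N})"

definition tensor_coset ::
  "('s, 'n) ring_scheme \<Rightarrow> ('r, 's, 'a, 'p) bimodule_scheme \<Rightarrow> ('s, 't, 'b, 'q) bimodule_scheme \<Rightarrow>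
   ('a \<times> 'b \<Rightarrow>\<^sub>0 int) \<Rightarrow> ('a \<times> 'b \<Rightarrow>\<^sub>0 int) set" where
  "tensor_coset S M N c =
    tensor_relations S M N #>\<^bsub>free_Abelian_group (carrier M \<times> carrier N)\<^esub> c"

definition pure_tensor ::
  "('s, 'n) ring_scheme \<Rightarrow> ('r, 's, 'a, 'p) bimodule_scheme \<Rightarrow> ('s, 't, 'b, 'q) bimodule_scheme \<Rightarrow>
   'a \<Rightarrow> 'b \<Rightarrow> ('a \<times> 'b \<Rightarrow>\<^sub>0 int) set" where
  "pure_tensor S M N x y = tensor_coset S M N (frag_of (x, y))"

text \<open>
  The two actions are induced by \<open>r(x \<otimes> y) = (rx) \<otimes> y\<close> and \<open>(x \<otimes> y)t = x \<otimes> (yt)\<close>. The union over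
  the representatives \<open>c\<close> of a coset \<open>X\<close> avoids a choice: all of them yield the same coset,
  see \<open>tensor_lsmult\<close>, \<open>tensor_rsmult\<close> and \<open>tensor_bimodule\<close> below.
\<close>

definition tensor_product ::
  "('s, 'n) ring_scheme \<Rightarrow> ('r, 's, 'a, 'p) bimodule_scheme \<Rightarrow> ('s, 't, 'b, 'q) bimodule_scheme \<Rightarrow>
   ('r, 't, ('a \<times> 'b \<Rightarrow>\<^sub>0 int) set) bimodule" where
  "tensor_product S M N =
    (let T = free_Abelian_group (carrier M \<times> carrier N) Mod tensor_relations S M N in
    \<lparr>carrier = carrier T, monoid.mult = undefined, one = undefined,
     ring.zero = one T, ring.add = monoid.mult T,
     lsmult = (\<lambda>r X. \<Union>c\<in>X. tensor_coset S M N (frag_extend (\<lambda>(x, y). frag_of (lsmult M r x, y)) c)),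
     rsmult = (\<lambda>X t. \<Union>c\<in>X. tensor_coset S M N (frag_extend (\<lambda>(x, y). frag_of (x, rsmult N y t)) c))\<rparr>)"

locale bimodule_pair = A: bimodule R S M + B: bimodule S T N
  for R :: "('r, 'm) ring_scheme" and S :: "('s, 'n) ring_scheme"
    and T :: "('t, 'o) ring_scheme"
    and M :: "('r, 's, 'a, 'p) bimodule_scheme" and N :: "('s, 't, 'b, 'q) bimodule_scheme"
begin

abbreviation "F \<equiv> free_Abelian_group (carrier M \<times> carrier N)"
abbreviation "rels \<equiv> tensor_relations S M N"
abbreviation "tcoset \<equiv> tensor_coset S M N"
abbreviation "lext r \<equiv> frag_extend (\<lambda>(x, y). frag_of (lsmult M r x, y) :: 'a \<times> 'b \<Rightarrow>\<^sub>0 int)"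
abbreviation "rext t \<equiv> frag_extend (\<lambda>(x, y). frag_of (x, rsmult N y t) :: 'a \<times> 'b \<Rightarrow>\<^sub>0 int)"

lemma keys_diff_subset: "Poly_Mapping.keys a \<subseteq> U \<Longrightarrow> Poly_Mapping.keys b \<subseteq> U \<Longrightarrow>
    Poly_Mapping.keys (a - b :: 'c \<Rightarrow>\<^sub>0 int) \<subseteq> U"
  by (meson Un_least order.trans keys_diff)

lemma keys_add_subset: "Poly_Mapping.keys a \<subseteq> U \<Longrightarrow> Poly_Mapping.keys b \<subseteq> U \<Longrightarrow>
    Poly_Mapping.keys (a + b :: 'c \<Rightarrow>\<^sub>0 int) \<subseteq> U"
  by (meson Un_least order.trans keys_add)

lemma subgroup_rels: "subgroup rels F"
  unfolding tensor_relations_def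
  by (rule group.generate_is_subgroup, simp,
      intro subsetI, elim UnE CollectE exE conjE, unfold carrier_free_Abelian_group_iff)
    (simp add: keys_diff_subset A.rsmult_closed B.lsmult_closed)+

lemma normal_rels: "rels \<lhd> F"
  by (simp add: abelian_free_Abelian_group comm_group.normal_iff_subgroup subgroup_rels)

lemma rels_keys: "b \<in> rels \<Longrightarrow> Poly_Mapping.keys b \<subseteq> carrier M \<times> carrier N"
  using subgroup.mem_carrier[OF subgroup_rels] by (simp only: carrier_free_Abelian_group_iff)

lemma rels_zero: "0 \<in> rels"
  using subgroup.one_closed[OF subgroup_rels] by simp

lemma rels_add: "a \<in> rels \<Longrightarrow> b \<in> rels \<Longrightarrow> a + b \<in> rels"
  using subgroup.m_closed[OF subgroup_rels] by force

lemma rels_minus: "a \<in> rels \<Longrightarrow> - a \<in> rels"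
  using subgroup.m_inv_closed[OF subgroup_rels, of a] rels_keys[of a] by simp

lemma rels_diff: "a \<in> rels \<Longrightarrow> b \<in> rels \<Longrightarrow> a - b \<in> rels"
  using rels_add[OF _ rels_minus, of a b] by simp

lemma rels_left: "\<lbrakk>x \<in> carrier M; x' \<in> carrier M; y \<in> carrier N\<rbrakk> \<Longrightarrow>
    frag_of (x \<oplus>\<^bsub>M\<^esub> x', y) - frag_of (x, y) - frag_of (x', y) \<in> rels"
  unfolding tensor_relations_def by (rule generate.incl) blast

lemma rels_right: "\<lbrakk>x \<in> carrier M; y \<in> carrier N; y' \<in> carrier N\<rbrakk> \<Longrightarrow>
    frag_of (x, y \<oplus>\<^bsub>N\<^esub> y') - frag_of (x, y) - frag_of (x, y') \<in> rels"
  unfolding tensor_relations_def by (rule generate.incl) blast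

lemma rels_middle: "\<lbrakk>x \<in> carrier M; s \<in> carrier S; y \<in> carrier N\<rbrakk> \<Longrightarrow>
    frag_of (rsmult M x s, y) - frag_of (x, lsmult N s y) \<in> rels"
  unfolding tensor_relations_def by (rule generate.incl) blast

lemma tcoset_iff: "z \<in> tcoset c \<longleftrightarrow> z - c \<in> rels"
  unfolding tensor_coset_def r_coset_def by force

lemma tcoset_eq: "tcoset c = tcoset d \<longleftrightarrow> c - d \<in> rels"
proof
  assume "tcoset c = tcoset d"
  moreover have "c \<in> tcoset c" by (simp add: tcoset_iff rels_zero)
  ultimately show "c - d \<in> rels" by (simp add: tcoset_iff)
next
  assume d: "c - d \<in> rels"
  show "tcoset c = tcoset d"
  proof (intro Set.set_eqI iffI)
    fix z assume "z \<in> tcoset c"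
    then show "z \<in> tcoset d" using rels_add[OF _ d, of "z - c"] by (simp add: tcoset_iff)
  next
    fix z assume "z \<in> tcoset d"
    then show "z \<in> tcoset c" using rels_diff[OF _ d, of "z - d"] by (simp add: tcoset_iff)
  qed
qed

lemma ext_rels:
  assumes gen: "\<And>x x' y. \<lbrakk>x \<in> carrier M; x' \<in> carrier M; y \<in> carrier N\<rbrakk> \<Longrightarrow>
      h (x \<oplus>\<^bsub>M\<^esub> x', y) - h (x, y) - h (x', y) \<in> rels"
    "\<And>x y y'. \<lbrakk>x \<in> carrier M; y \<in> carrier N; y' \<in> carrier N\<rbrakk> \<Longrightarrow>
      h (x, y \<oplus>\<^bsub>N\<^esub> y') - h (x, y) - h (x, y') \<in> rels"
    "\<And>x s y. \<lbrakk>x \<in> carrier M; s \<in> carrier S; y \<in> carrier N\<rbrakk> \<Longrightarrow>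
      h (rsmult M x s, y) - h (x, lsmult N s y) \<in> rels"
    and b: "b \<in> rels"
  shows "frag_extend h b \<in> rels"
proof -
  have "frag_extend h b \<in> rels \<and> b \<in> rels"
    using b unfolding tensor_relations_def[of S M N]
  proof (induction b rule: generate.induct)
    case one
    then show ?case by (simp add: rels_zero flip: tensor_relations_def)
  next
    case (incl g)
    then have "g \<in> rels" unfolding tensor_relations_def by (rule generate.incl)
    with incl show ?case
      unfolding tensor_relations_def[of S M N, symmetric]
      by (auto simp: frag_extend_diff gen)
  next
    case (inv g)
    then have g: "g \<in> rels" unfolding tensor_relations_def by (rule generate.incl)
    with inv have "frag_extend h g \<in> rels"
      by (auto simp: frag_extend_diff gen)
    with g rels_keys[OF g] show ?case
      unfolding tensor_relations_def[of S M N, symmetric]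
      by (simp add: frag_extend_minus rels_minus)
  next
    case (eng g1 g2)
    then show ?case
      unfolding tensor_relations_def[of S M N, symmetric]
      by (simp add: frag_extend_add rels_add)
  qed
  then show ?thesis by simp
qed

lemma lext_rels: "r \<in> carrier R \<Longrightarrow> b \<in> rels \<Longrightarrow> lext r b \<in> rels"
  by (rule ext_rels)
    (auto simp: A.lsmult_add_right A.lsmult_rsmult[symmetric] A.lsmult_closed
      intro: rels_left rels_right rels_middle)

lemma rext_rels: "t \<in> carrier T \<Longrightarrow> b \<in> rels \<Longrightarrow> rext t b \<in> rels"
  by (rule ext_rels)
    (auto simp: B.rsmult_add_left B.lsmult_rsmult B.rsmult_closed
      intro: rels_left rels_right rels_middle)

lemma lext_keys:
  "\<lbrakk>r \<in> carrier R; Poly_Mapping.keys c \<subseteq> carrier M \<times> carrier N\<rbrakk> \<Longrightarrow>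
    Poly_Mapping.keys (lext r c) \<subseteq> carrier M \<times> carrier N"
  by (rule order_trans[OF keys_frag_extend]) (auto simp: A.lsmult_closed)

lemma rext_keys:
  "\<lbrakk>t \<in> carrier T; Poly_Mapping.keys c \<subseteq> carrier M \<times> carrier N\<rbrakk> \<Longrightarrow>
    Poly_Mapping.keys (rext t c) \<subseteq> carrier M \<times> carrier N"
  by (rule order_trans[OF keys_frag_extend]) (auto simp: B.rsmult_closed)

lemma ext_Union:
  assumes "\<And>b. b \<in> rels \<Longrightarrow> frag_extend h b \<in> rels"
  shows "(\<Union>d\<in>tcoset c. tcoset (frag_extend h d)) = tcoset (frag_extend h c)"
proof -
  have "tcoset (frag_extend h d) = tcoset (frag_extend h c)" if "d \<in> tcoset c" for d
    using assms that unfolding tcoset_eq tcoset_iff frag_extend_diff[symmetric] by blast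
  moreover have "c \<in> tcoset c" by (simp add: tcoset_iff rels_zero)
  ultimately show ?thesis by blast
qed

lemma tensor_lsmult:
  "r \<in> carrier R \<Longrightarrow> lsmult (tensor_product S M N) r (tcoset c) = tcoset (lext r c)"
  by (simp add: tensor_product_def Let_def ext_Union lext_rels)

lemma tensor_rsmult:
  "t \<in> carrier T \<Longrightarrow> rsmult (tensor_product S M N) (tcoset c) t = tcoset (rext t c)"
  by (simp add: tensor_product_def Let_def ext_Union rext_rels)

lemma tensor_add:
  "\<lbrakk>Poly_Mapping.keys c \<subseteq> carrier M \<times> carrier N; Poly_Mapping.keys d \<subseteq> carrier M \<times> carrier N\<rbrakk> \<Longrightarrow>
    tcoset c \<oplus>\<^bsub>tensor_product S M N\<^esub> tcoset d = tcoset (c + d)"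
  using normal.rcos_sum[OF normal_rels, of c d]
  by (simp add: tensor_product_def Let_def FactGroup_def tensor_coset_def)

lemma tensor_carrier:
  "carrier (tensor_product S M N) = tcoset ` {c. Poly_Mapping.keys c \<subseteq> carrier M \<times> carrier N}"
  by (auto simp: tensor_product_def Let_def FactGroup_def RCOSETS_def tensor_coset_def)

lemma tensor_abelian_group: "abelian_group (tensor_product S M N)"
proof -
  interpret Q: comm_group "F Mod rels"
    by (rule comm_group.abelian_FactGroup[OF abelian_free_Abelian_group subgroup_rels])
  have eqs: "carrier (tensor_product S M N) = carrier (F Mod rels)"
    "add (tensor_product S M N) = monoid.mult (F Mod rels)"
    "ring.zero (tensor_product S M N) = one (F Mod rels)"
    by (simp_all add: tensor_product_def Let_def)
  show ?thesis
    by (rule abelian_groupI, simp_all only: Q.m_closed Q.one_closed Q.l_one Q.m_assoc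
        Q.l_inv_ex eqs) (rule Q.m_comm)
qed

lemma frag_extend_cong_rels:
  assumes "Poly_Mapping.keys c \<subseteq> carrier M \<times> carrier N"
    and "\<And>x y. \<lbrakk>x \<in> carrier M; y \<in> carrier N\<rbrakk> \<Longrightarrow> f (frag_of (x, y)) \<in> rels"
    and "f 0 = 0" "\<And>a b. f (a - b) = f a - f b"
  shows "f c \<in> rels"
  using assms(1) by (induction c rule: frag_induction) (auto simp: assms(2-4) rels_zero rels_diff)

lemma tensor_bimodule: "bimodule R T (tensor_product S M N)"
proof (intro bimodule.intro bimodule_axioms.intro A.R.nonunital_ring_axioms
    B.S.nonunital_ring_axioms tensor_abelian_group)
  let ?U = "tensor_product S M N"
  fix r r' t t' u v
  note [simp] = tensor_lsmult tensor_rsmult tensor_add lext_keys rext_keys keys_add_subset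
    frag_extend_add frag_extend_diff A.lsmult_closed B.rsmult_closed
  { assume r: "r \<in> carrier R" "u \<in> carrier ?U"
    then show "lsmult ?U r u \<in> carrier ?U"
      by (auto simp: tensor_carrier)
    assume "v \<in> carrier ?U"
    with r show "lsmult ?U r (u \<oplus>\<^bsub>?U\<^esub> v) = lsmult ?U r u \<oplus>\<^bsub>?U\<^esub> lsmult ?U r v"
      by (auto simp: tensor_carrier) }
  { assume t: "u \<in> carrier ?U" "t \<in> carrier T"
    then show "rsmult ?U u t \<in> carrier ?U"
      by (auto simp: tensor_carrier)
    assume "v \<in> carrier ?U"
    with t show "rsmult ?U (u \<oplus>\<^bsub>?U\<^esub> v) t = rsmult ?U u t \<oplus>\<^bsub>?U\<^esub> rsmult ?U v t"
      by (auto simp: tensor_carrier) }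
  { assume r: "r \<in> carrier R" "r' \<in> carrier R" "u \<in> carrier ?U"
    then obtain c where c: "u = tcoset c" "Poly_Mapping.keys c \<subseteq> carrier M \<times> carrier N"
      by (auto simp: tensor_carrier)
    have "lext (r \<oplus>\<^bsub>R\<^esub> r') c - (lext r c + lext r' c) \<in> rels"
      using c(2)
      by (rule frag_extend_cong_rels)
        (use r in \<open>auto simp: A.lsmult_add_left rels_left simp flip: diff_diff_eq\<close>)
    with r c show "lsmult ?U (r \<oplus>\<^bsub>R\<^esub> r') u = lsmult ?U r u \<oplus>\<^bsub>?U\<^esub> lsmult ?U r' u"
      by (simp add: tcoset_eq)
    have "lext (r \<otimes>\<^bsub>R\<^esub> r') c - lext r (lext r' c) \<in> rels"
      using c(2)
      by (rule frag_extend_cong_rels) (use r in \<open>auto simp: A.lsmult_assoc rels_zero algebra_simps\<close>)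
    with r c show "lsmult ?U (r \<otimes>\<^bsub>R\<^esub> r') u = lsmult ?U r (lsmult ?U r' u)"
      by (simp add: tcoset_eq A.R.mult_closed) }
  { assume r: "u \<in> carrier ?U" "t \<in> carrier T" "t' \<in> carrier T"
    then obtain c where c: "u = tcoset c" "Poly_Mapping.keys c \<subseteq> carrier M \<times> carrier N"
      by (auto simp: tensor_carrier)
    have "rext (t \<oplus>\<^bsub>T\<^esub> t') c - (rext t c + rext t' c) \<in> rels"
      using c(2)
      by (rule frag_extend_cong_rels)
        (use r in \<open>auto simp: B.rsmult_add_right rels_right simp flip: diff_diff_eq\<close>)
    with r c show "rsmult ?U u (t \<oplus>\<^bsub>T\<^esub> t') = rsmult ?U u t \<oplus>\<^bsub>?U\<^esub> rsmult ?U u t'"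
      by (simp add: tcoset_eq)
    have "rext (t \<otimes>\<^bsub>T\<^esub> t') c - rext t' (rext t c) \<in> rels"
      using c(2)
      by (rule frag_extend_cong_rels) (use r in \<open>auto simp: B.rsmult_assoc rels_zero algebra_simps\<close>)
    with r c show "rsmult ?U u (t \<otimes>\<^bsub>T\<^esub> t') = rsmult ?U (rsmult ?U u t) t'"
      by (simp add: tcoset_eq B.S.mult_closed) }
  { assume r: "r \<in> carrier R" "u \<in> carrier ?U" "t \<in> carrier T"
    then obtain c where c: "u = tcoset c" "Poly_Mapping.keys c \<subseteq> carrier M \<times> carrier N"
      by (auto simp: tensor_carrier)
    have "rext t (lext r c) - lext r (rext t c) \<in> rels"
      using c(2)
      by (rule frag_extend_cong_rels) (use r in \<open>auto simp: rels_zero algebra_simps\<close>)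
    with r c show "rsmult ?U (lsmult ?U r u) t = lsmult ?U r (rsmult ?U u t)"
      by (simp add: tcoset_eq) }
qed

end


section \<open>Generalized matrix rings\<close>

text \<open>
  All entries are taken from one type \<open>'a\<close>, each \<open>M i j\<close> having its own carrier, operations and
  zero; the family is indexed by \<open>{1..n}\<close>. The morphism \<open>\<theta> i j k\<close> is
  \<open>\<theta>\<^sub>i\<^sub>j\<^sub>k : M\<^sub>i\<^sub>j \<otimes> M\<^sub>j\<^sub>k \<rightarrow> M\<^sub>i\<^sub>k\<close>, and \<open>entry_mult\<close> is \<open>m\<^sub>i\<^sub>j m\<^sub>j\<^sub>k := \<theta>\<^sub>i\<^sub>j\<^sub>k (m\<^sub>i\<^sub>j \<otimes> m\<^sub>j\<^sub>k)\<close>.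
\<close>

type_synonym 'a entry_rings = "nat \<Rightarrow> 'a ring"
type_synonym 'a entry_bimodules = "nat \<Rightarrow> nat \<Rightarrow> ('a, 'a, 'a) bimodule"
type_synonym 'a entry_maps = "nat \<Rightarrow> nat \<Rightarrow> nat \<Rightarrow> ('a \<times> 'a \<Rightarrow>\<^sub>0 int) set \<Rightarrow> 'a"

definition entry_mult ::
  "'a entry_rings \<Rightarrow> 'a entry_bimodules \<Rightarrow> 'a entry_maps \<Rightarrow> nat \<Rightarrow> nat \<Rightarrow> nat \<Rightarrow> 'a \<Rightarrow> 'a \<Rightarrow> 'a" where
  "entry_mult R M \<theta> i j k x y = \<theta> i j k (pure_tensor (R j) (M i j) (M j k) x y)"

text \<open>
  \<open>\<theta>\<^sub>i\<^sub>i\<^sub>i\<close> being the multiplication of \<open>R\<^sub>i\<close> is the case \<open>i = j\<close> of \<open>entry_mult_left\<close>.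
\<close>

locale generalized_matrix_ring =
  fixes n :: nat and R :: "'a entry_rings" and M :: "'a entry_bimodules" and \<theta> :: "'a entry_maps"
  assumes bimodules: "\<lbrakk>i \<in> {1..n}; j \<in> {1..n}\<rbrakk> \<Longrightarrow> bimodule (R i) (R j) (M i j)"
    and diagonal: "i \<in> {1..n} \<Longrightarrow> M i i = regular_bimodule (R i)"
    and theta_bimodule_hom: "\<lbrakk>i \<in> {1..n}; j \<in> {1..n}; k \<in> {1..n}\<rbrakk> \<Longrightarrow>
      \<theta> i j k \<in> bimodule_hom (R i) (R k) (tensor_product (R j) (M i j) (M j k)) (M i k)"
    and entry_mult_left: "\<lbrakk>i \<in> {1..n}; j \<in> {1..n}; r \<in> carrier (R i); x \<in> carrier (M i j)\<rbrakk> \<Longrightarrow>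
      entry_mult R M \<theta> i i j r x = lsmult (M i j) r x"
    and entry_mult_right: "\<lbrakk>i \<in> {1..n}; j \<in> {1..n}; x \<in> carrier (M i j); s \<in> carrier (R j)\<rbrakk> \<Longrightarrow>
      entry_mult R M \<theta> i j j x s = rsmult (M i j) x s"
    and entry_mult_assoc: "\<lbrakk>i \<in> {1..n}; j \<in> {1..n}; k \<in> {1..n}; l \<in> {1..n};
      x \<in> carrier (M i j); y \<in> carrier (M j k); z \<in> carrier (M k l)\<rbrakk> \<Longrightarrow>
      entry_mult R M \<theta> i k l (entry_mult R M \<theta> i j k x y) z =
      entry_mult R M \<theta> i j l x (entry_mult R M \<theta> j k l y z)"

text \<open>Arrays are extensional functions on \<open>{1..n} \<times> {1..n}\<close>.\<close>

definition matrix_ring ::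
  "nat \<Rightarrow> 'a entry_rings \<Rightarrow> 'a entry_bimodules \<Rightarrow> 'a entry_maps \<Rightarrow> (nat \<times> nat \<Rightarrow> 'a) ring" where
  "matrix_ring n R M \<theta> =
    \<lparr>carrier = (\<Pi>\<^sub>E (i, k) \<in> {1..n} \<times> {1..n}. carrier (M i k)),
     monoid.mult = (\<lambda>A B. \<lambda>(i, k) \<in> {1..n} \<times> {1..n}.
       \<Oplus>\<^bsub>M i k\<^esub> j \<in> {1..n}. entry_mult R M \<theta> i j k (A (i, j)) (B (j, k))),
     one = undefined,
     ring.zero = (\<lambda>(i, k) \<in> {1..n} \<times> {1..n}. \<zero>\<^bsub>M i k\<^esub>),
     ring.add = (\<lambda>A B. \<lambda>(i, k) \<in> {1..n} \<times> {1..n}. A (i, k) \<oplus>\<^bsub>M i k\<^esub> B (i, k))\<rparr>"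

text \<open>
  For subsets \<open>X \<subseteq> M\<^sub>i\<^sub>j\<close> and \<open>Y \<subseteq> M\<^sub>j\<^sub>k\<close>, the product \<open>XY\<close> is the additive subgroup of \<open>M\<^sub>i\<^sub>k\<close>
  generated by the products of elements.
\<close>

definition product_subgroup ::
  "'a entry_rings \<Rightarrow> 'a entry_bimodules \<Rightarrow> 'a entry_maps \<Rightarrow> nat \<Rightarrow> nat \<Rightarrow> nat \<Rightarrow>
   'a set \<Rightarrow> 'a set \<Rightarrow> 'a set" where
  "product_subgroup R M \<theta> i j k X Y =
    generate (add_monoid (M i k)) {entry_mult R M \<theta> i j k x y | x y. x \<in> X \<and> y \<in> Y}"

definition family_symmetric_entry ::
  "'a entry_rings \<Rightarrow> 'a entry_bimodules \<Rightarrow> 'a entry_maps \<Rightarrow> (nat \<Rightarrow> 'a set) \<Rightarrow> nat \<Rightarrow> nat \<Rightarrow> bool" where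
  "family_symmetric_entry R M \<theta> \<I> i j \<longleftrightarrow>
    product_subgroup R M \<theta> i i j (\<I> i) (carrier (M i j)) =
    product_subgroup R M \<theta> i j j (carrier (M i j)) (\<I> j)"

definition family_symmetric ::
  "nat \<Rightarrow> 'a entry_rings \<Rightarrow> 'a entry_bimodules \<Rightarrow> 'a entry_maps \<Rightarrow> (nat \<Rightarrow> 'a set) \<Rightarrow> bool" where
  "family_symmetric n R M \<theta> \<I> \<longleftrightarrow>
    (\<forall>i\<in>{1..n}. \<forall>j\<in>{1..n}. family_symmetric_entry R M \<theta> \<I> i j)"

definition ideal_entry ::
  "'a entry_rings \<Rightarrow> 'a entry_bimodules \<Rightarrow> 'a entry_maps \<Rightarrow> (nat \<Rightarrow> 'a set) \<Rightarrow> nat \<Rightarrow> nat \<Rightarrow> 'a set" where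
  "ideal_entry R M \<theta> \<I> j k =
    product_subgroup R M \<theta> j j k (\<I> j) (carrier (M j k)) <+>\<^bsub>M j k\<^esub>
    product_subgroup R M \<theta> j k k (carrier (M j k)) (\<I> k)"

definition ideal_arrays ::
  "nat \<Rightarrow> 'a entry_rings \<Rightarrow> 'a entry_bimodules \<Rightarrow> 'a entry_maps \<Rightarrow> (nat \<Rightarrow> 'a set) \<Rightarrow>
   (nat \<times> nat \<Rightarrow> 'a) set" where
  "ideal_arrays n R M \<theta> \<I> =
    {A \<in> carrier (matrix_ring n R M \<theta>). \<forall>j\<in>{1..n}. \<forall>k\<in>{1..n}. A (j, k) \<in> ideal_entry R M \<theta> \<I> j k}"

end

theory Submission
  imports Defs
begin

text \<open>
  Symmetry makes the two summands of \<open>I\<^sub>j\<^sub>k = I\<^sub>j M\<^sub>j\<^sub>k + M\<^sub>j\<^sub>k I\<^sub>k\<close> coincide, so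
  \<open>I\<^sub>j\<^sub>k = I\<^sub>j M\<^sub>j\<^sub>k = M\<^sub>j\<^sub>k I\<^sub>k\<close> (\<open>ideal_entry_symmetric\<close>), and one may choose the description that
  suits the side of a multiplication. A left factor is absorbed by the second one,
  \<open>M\<^sub>i\<^sub>j (M\<^sub>j\<^sub>k I\<^sub>k) = (M\<^sub>i\<^sub>j M\<^sub>j\<^sub>k) I\<^sub>k \<subseteq> M\<^sub>i\<^sub>k I\<^sub>k\<close> (\<open>mul_product_subgroup_left\<close>), a right factor by the
  first one, \<open>(I\<^sub>i M\<^sub>i\<^sub>j) M\<^sub>j\<^sub>k = I\<^sub>i (M\<^sub>i\<^sub>j M\<^sub>j\<^sub>k) \<subseteq> I\<^sub>i M\<^sub>i\<^sub>k\<close> (\<open>mul_product_subgroup_right\<close>). Without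
  symmetry, the product \<open>M\<^sub>i\<^sub>j I\<^sub>j M\<^sub>j\<^sub>k\<close> could leave \<open>I\<^sub>i\<^sub>k\<close>.

  An entry of a product of arrays is a finite sum of products of entries, so a family of
  additive subgroups absorbing such products on both sides is the family of entries of an
  ideal (\<open>entrywise_ideal\<close>).

  That the arrays form a ring at all has to be shown as well. It rests on the biadditivity of
  the product of entries, which comes from the additive relations of the tensor product and
  the additivity of \<open>\<theta>\<close>, on the associativity of that product, and on interchanging two
  finite sums.
\<close>


section \<open>Finite sums in abelian groups\<close>

lemma (in abelian_group_hom) hom_finsum:
  assumes "f \<in> A \<rightarrow> carrier G"
  shows "h (\<Oplus>\<^bsub>G\<^esub>x\<in>A. f x) = (\<Oplus>\<^bsub>H\<^esub>x\<in>A. h (f x))"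
  using assms by (induction A rule: infinite_finite_induct) (auto simp: Pi_iff)

lemma (in abelian_monoid) finsum_swap:
  assumes "finite A" "finite B" "\<And>x y. x \<in> A \<Longrightarrow> y \<in> B \<Longrightarrow> f x y \<in> carrier G"
  shows "(\<Oplus>x\<in>A. \<Oplus>y\<in>B. f x y) = (\<Oplus>y\<in>B. \<Oplus>x\<in>A. f x y)"
  using assms(1,3)
proof (induction A rule: finite_induct)
  case empty
  then show ?case by simp
next
  case (insert a A)
  have "(\<Oplus>y\<in>B. \<Oplus>x\<in>insert a A. f x y) = (\<Oplus>y\<in>B. f a y \<oplus> (\<Oplus>x\<in>A. f x y))"
    by (rule finsum_cong') (use insert in \<open>auto intro!: finsum_closed\<close>)
  also have "\<dots> = (\<Oplus>y\<in>B. f a y) \<oplus> (\<Oplus>y\<in>B. \<Oplus>x\<in>A. f x y)"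
    by (rule finsum_addf) (use insert in \<open>auto intro!: finsum_closed\<close>)
  finally show ?case
    using insert by (subst finsum_insert) (auto intro!: finsum_closed)
qed

lemma (in abelian_group) finsum_in_additive_subgroup:
  assumes "additive_subgroup H G" "\<And>x. x \<in> A \<Longrightarrow> f x \<in> H"
  shows "(\<Oplus>x\<in>A. f x) \<in> H"
proof -
  interpret additive_subgroup H G by fact
  show ?thesis
    using assms(2) a_subset by (induction A rule: infinite_finite_induct) (auto simp: subset_iff)
qed

text \<open>
  A product subgroup is generated by products, so inclusions between such subgroups can be
  tested on generators.
\<close>

lemma (in abelian_group_hom) hom_generate_subset:
  assumes "additive_subgroup K H" "S \<subseteq> carrier G" "\<And>s. s \<in> S \<Longrightarrow> h s \<in> K"
    and "x \<in> generate (add_monoid G) S"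
  shows "h x \<in> K"
proof -
  have "h x \<in> generate (add_monoid H) (h ` S)"
    using group_hom.generate_img[OF a_group_hom, of S] assms(2,4) by auto
  moreover have "generate (add_monoid H) (h ` S) \<subseteq> K"
    using assms(3) additive_subgroup.a_subgroup[OF assms(1)]
    by (intro group.generate_subgroup_incl H.a_group) auto
  ultimately show ?thesis by blast
qed


section \<open>The product of entries\<close>

context generalized_matrix_ring
begin

abbreviation mul :: "nat \<Rightarrow> nat \<Rightarrow> nat \<Rightarrow> 'a \<Rightarrow> 'a \<Rightarrow> 'a" where
  "mul \<equiv> entry_mult R M \<theta>"

lemma entry_abelian_group:
  assumes "i \<in> {1..n}" "j \<in> {1..n}"
  shows "abelian_group (M i j)"
proof -
  interpret bimodule "R i" "R j" "M i j" by (rule bimodules[OF assms])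
  show ?thesis by (rule M.abelian_group_axioms)
qed

lemma carrier_diagonal: "i \<in> {1..n} \<Longrightarrow> carrier (M i i) = carrier (R i)"
  by (simp add: diagonal regular_bimodule_def)

text \<open>
  Biadditivity of \<open>(x, y) \<mapsto> \<theta>\<^sub>i\<^sub>j\<^sub>k (x \<otimes> y)\<close>: the pure tensors are biadditive because the
  differences in question are among the relations of the tensor product, and \<open>\<theta>\<^sub>i\<^sub>j\<^sub>k\<close> is
  additive.
\<close>

lemma mul_closed_and_biadditive:
  assumes ijk: "i \<in> {1..n}" "j \<in> {1..n}" "k \<in> {1..n}"
    and x: "x \<in> carrier (M i j)" and y: "y \<in> carrier (M j k)"
  shows mul_closed: "mul i j k x y \<in> carrier (M i k)"
    and mul_add_left: "x' \<in> carrier (M i j) \<Longrightarrow>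
      mul i j k (x \<oplus>\<^bsub>M i j\<^esub> x') y = mul i j k x y \<oplus>\<^bsub>M i k\<^esub> mul i j k x' y"
    and mul_add_right: "y' \<in> carrier (M j k) \<Longrightarrow>
      mul i j k x (y \<oplus>\<^bsub>M j k\<^esub> y') = mul i j k x y \<oplus>\<^bsub>M i k\<^esub> mul i j k x y'"
proof -
  interpret bimodule_pair "R i" "R j" "R k" "M i j" "M j k"
    by (intro bimodule_pair.intro bimodules ijk)
  let ?T = "tensor_product (R j) (M i j) (M j k)"
  have hom: "\<theta> i j k \<in> hom (add_monoid ?T) (add_monoid (M i k))"
    using theta_bimodule_hom[OF ijk] by (simp add: bimodule_hom_def)
  have pure: "tcoset (frag_of (a, b)) \<in> carrier ?T"
    if "a \<in> carrier (M i j)" "b \<in> carrier (M j k)" for a b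
    using that by (auto simp: tensor_carrier)
  have theta_add: "\<theta> i j k (u \<oplus>\<^bsub>?T\<^esub> v) = \<theta> i j k u \<oplus>\<^bsub>M i k\<^esub> \<theta> i j k v"
    if "u \<in> carrier ?T" "v \<in> carrier ?T" for u v
    using hom_mult[OF hom, of u v] that by simp
  show "mul i j k x y \<in> carrier (M i k)"
    using hom_in_carrier[OF hom] pure[OF x y] by (simp add: entry_mult_def pure_tensor_def)
  show "mul i j k (x \<oplus>\<^bsub>M i j\<^esub> x') y = mul i j k x y \<oplus>\<^bsub>M i k\<^esub> mul i j k x' y"
    if x': "x' \<in> carrier (M i j)"
  proof -
    have "tcoset (frag_of (x \<oplus>\<^bsub>M i j\<^esub> x', y)) =
        tcoset (frag_of (x, y) + frag_of (x', y))"
      using rels_left[OF x x' y] by (simp add: tcoset_eq diff_diff_eq)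
    also have "\<dots> = tcoset (frag_of (x, y)) \<oplus>\<^bsub>?T\<^esub> tcoset (frag_of (x', y))"
      using x x' y by (subst tensor_add) auto
    finally show ?thesis
      using pure x x' y by (simp add: entry_mult_def pure_tensor_def theta_add)
  qed
  show "mul i j k x (y \<oplus>\<^bsub>M j k\<^esub> y') = mul i j k x y \<oplus>\<^bsub>M i k\<^esub> mul i j k x y'"
    if y': "y' \<in> carrier (M j k)"
  proof -
    have "tcoset (frag_of (x, y \<oplus>\<^bsub>M j k\<^esub> y')) =
        tcoset (frag_of (x, y) + frag_of (x, y'))"
      using rels_right[OF x y y'] by (simp add: tcoset_eq diff_diff_eq)
    also have "\<dots> = tcoset (frag_of (x, y)) \<oplus>\<^bsub>?T\<^esub> tcoset (frag_of (x, y'))"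
      using x y' y by (subst tensor_add) auto
    finally show ?thesis
      using pure x y' y by (simp add: entry_mult_def pure_tensor_def theta_add)
  qed
qed

lemma mul_hom_left:
  assumes "i \<in> {1..n}" "j \<in> {1..n}" "k \<in> {1..n}" "y \<in> carrier (M j k)"
  shows "abelian_group_hom (M i j) (M i k) (\<lambda>x. mul i j k x y)"
proof -
  interpret A: abelian_group "M i j" using assms by (intro entry_abelian_group)
  interpret B: abelian_group "M i k" using assms by (intro entry_abelian_group)
  show ?thesis
    by (intro abelian_group_homI A.abelian_group_axioms B.abelian_group_axioms
        group_hom.intro group_hom_axioms.intro A.a_group B.a_group homI)
      (use assms in \<open>auto intro!: mul_closed mul_add_left\<close>)
qed

lemma mul_hom_right:
  assumes "i \<in> {1..n}" "j \<in> {1..n}" "k \<in> {1..n}" "x \<in> carrier (M i j)"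
  shows "abelian_group_hom (M j k) (M i k) (mul i j k x)"
proof -
  interpret A: abelian_group "M j k" using assms by (intro entry_abelian_group)
  interpret B: abelian_group "M i k" using assms by (intro entry_abelian_group)
  show ?thesis
    by (intro abelian_group_homI A.abelian_group_axioms B.abelian_group_axioms
        group_hom.intro group_hom_axioms.intro A.a_group B.a_group homI)
      (use assms in \<open>auto intro!: mul_closed mul_add_right\<close>)
qed


section \<open>The ring of arrays\<close>

abbreviation arrays :: "(nat \<times> nat \<Rightarrow> 'a) ring" where
  "arrays \<equiv> matrix_ring n R M \<theta>"

lemma arrays_carrier_iff:
  "A \<in> carrier arrays \<longleftrightarrow> A \<in> extensional ({1..n} \<times> {1..n}) \<and>
    (\<forall>i\<in>{1..n}. \<forall>k\<in>{1..n}. A (i, k) \<in> carrier (M i k))"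
  by (auto simp: matrix_ring_def PiE_iff)

lemma array_entry:
  "\<lbrakk>A \<in> carrier arrays; i \<in> {1..n}; k \<in> {1..n}\<rbrakk> \<Longrightarrow> A (i, k) \<in> carrier (M i k)"
  by (simp add: arrays_carrier_iff)

lemma arrays_eqI:
  assumes "A \<in> carrier arrays" "B \<in> carrier arrays"
    and "\<And>i k. \<lbrakk>i \<in> {1..n}; k \<in> {1..n}\<rbrakk> \<Longrightarrow> A (i, k) = B (i, k)"
  shows "A = B"
  by (rule extensionalityI[of _ "{1..n} \<times> {1..n}"])
    (use assms in \<open>auto simp: arrays_carrier_iff\<close>)

lemma arrays_apply:
  assumes "i \<in> {1..n}" "k \<in> {1..n}"
  shows arrays_add_apply: "(A \<oplus>\<^bsub>arrays\<^esub> B) (i, k) = A (i, k) \<oplus>\<^bsub>M i k\<^esub> B (i, k)"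
    and arrays_zero_apply: "\<zero>\<^bsub>arrays\<^esub> (i, k) = \<zero>\<^bsub>M i k\<^esub>"
    and arrays_mult_apply: "(A \<otimes>\<^bsub>arrays\<^esub> B) (i, k) =
      (\<Oplus>\<^bsub>M i k\<^esub>j\<in>{1..n}. mul i j k (A (i, j)) (B (j, k)))"
  using assms by (simp_all add: matrix_ring_def)

lemma arrays_closed:
  shows arrays_zero_closed: "\<zero>\<^bsub>arrays\<^esub> \<in> carrier arrays"
    and arrays_add_closed: "\<lbrakk>A \<in> carrier arrays; B \<in> carrier arrays\<rbrakk> \<Longrightarrow>
      A \<oplus>\<^bsub>arrays\<^esub> B \<in> carrier arrays"
    and arrays_mult_closed: "\<lbrakk>A \<in> carrier arrays; B \<in> carrier arrays\<rbrakk> \<Longrightarrow>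
      A \<otimes>\<^bsub>arrays\<^esub> B \<in> carrier arrays"
proof -
  have ext: "\<zero>\<^bsub>arrays\<^esub> \<in> extensional ({1..n} \<times> {1..n})"
    "A \<oplus>\<^bsub>arrays\<^esub> B \<in> extensional ({1..n} \<times> {1..n})"
    "A \<otimes>\<^bsub>arrays\<^esub> B \<in> extensional ({1..n} \<times> {1..n})"
    by (simp_all add: matrix_ring_def)
  have grp: "abelian_group (M i k)" "abelian_monoid (M i k)"
    if "i \<in> {1..n}" "k \<in> {1..n}" for i k
    using entry_abelian_group[OF that] by (auto intro: abelian_group.axioms)
  show "\<zero>\<^bsub>arrays\<^esub> \<in> carrier arrays"
    using ext grp by (auto simp: arrays_carrier_iff arrays_apply abelian_monoid.zero_closed)
  show "A \<oplus>\<^bsub>arrays\<^esub> B \<in> carrier arrays" if "A \<in> carrier arrays" "B \<in> carrier arrays"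
    using ext grp that
    by (auto simp: arrays_carrier_iff arrays_apply intro!: abelian_monoid.a_closed)
  show "A \<otimes>\<^bsub>arrays\<^esub> B \<in> carrier arrays" if "A \<in> carrier arrays" "B \<in> carrier arrays"
    using ext grp that
    by (auto simp: arrays_carrier_iff arrays_apply intro!: abelian_monoid.finsum_closed mul_closed)
qed

text \<open>
  The additive inverse is given entry by entry, because \<open>\<ominus>\<close> of the ring of arrays can only be
  reasoned about once its addition is known to be a group.
\<close>

definition array_minus :: "(nat \<times> nat \<Rightarrow> 'a) \<Rightarrow> nat \<times> nat \<Rightarrow> 'a" where
  "array_minus A = (\<lambda>(i, k)\<in>{1..n} \<times> {1..n}. \<ominus>\<^bsub>M i k\<^esub> A (i, k))"

lemma array_minus_closed: "A \<in> carrier arrays \<Longrightarrow> array_minus A \<in> carrier arrays"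
  by (auto simp: arrays_carrier_iff array_minus_def
      intro!: abelian_group.a_inv_closed entry_abelian_group)

lemma array_minus_add:
  "A \<in> carrier arrays \<Longrightarrow> array_minus A \<oplus>\<^bsub>arrays\<^esub> A = \<zero>\<^bsub>arrays\<^esub>"
proof (rule arrays_eqI)
  fix i k assume A: "A \<in> carrier arrays" and ik: "i \<in> {1..n}" "k \<in> {1..n}"
  show "(array_minus A \<oplus>\<^bsub>arrays\<^esub> A) (i, k) = \<zero>\<^bsub>arrays\<^esub> (i, k)"
    using abelian_group.l_neg[OF entry_abelian_group[OF ik] array_entry[OF A ik]] ik
    by (simp add: arrays_apply array_minus_def)
qed (intro arrays_closed array_minus_closed; assumption)+

lemma arrays_abelian_group: "abelian_group arrays"
proof (rule abelian_groupI)
  note am = entry_abelian_group[THEN abelian_group.axioms(1)]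
  fix A B C
  assume A: "A \<in> carrier arrays"
  show "\<zero>\<^bsub>arrays\<^esub> \<oplus>\<^bsub>arrays\<^esub> A = A"
    by (rule arrays_eqI)
      (use A in \<open>auto simp: arrays_closed arrays_apply
        intro!: abelian_monoid.l_zero am array_entry\<close>)
  show "\<exists>B\<in>carrier arrays. B \<oplus>\<^bsub>arrays\<^esub> A = \<zero>\<^bsub>arrays\<^esub>"
    using array_minus_closed array_minus_add A by blast
  assume B: "B \<in> carrier arrays"
  show "A \<oplus>\<^bsub>arrays\<^esub> B = B \<oplus>\<^bsub>arrays\<^esub> A"
    by (rule arrays_eqI)
      (use A B in \<open>auto simp: arrays_closed arrays_apply
        intro!: abelian_monoid.a_comm am array_entry\<close>)
  assume C: "C \<in> carrier arrays"
  show "A \<oplus>\<^bsub>arrays\<^esub> B \<oplus>\<^bsub>arrays\<^esub> C = A \<oplus>\<^bsub>arrays\<^esub> (B \<oplus>\<^bsub>arrays\<^esub> C)"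
    by (rule arrays_eqI)
      (use A B C in \<open>auto simp: arrays_closed arrays_apply
        intro!: abelian_monoid.a_assoc am array_entry\<close>)
qed (auto simp: arrays_closed)

text \<open>
  Both sides of associativity expand, at position \<open>(i, l)\<close>, to the double sum of
  \<open>a\<^sub>i\<^sub>j (b\<^sub>j\<^sub>k c\<^sub>k\<^sub>l)\<close> over \<open>j\<close> and \<open>k\<close>, in the two orders of summation.
\<close>

lemma arrays_mult_assoc:
  assumes A: "A \<in> carrier arrays" and B: "B \<in> carrier arrays" and C: "C \<in> carrier arrays"
  shows "(A \<otimes>\<^bsub>arrays\<^esub> B) \<otimes>\<^bsub>arrays\<^esub> C = A \<otimes>\<^bsub>arrays\<^esub> (B \<otimes>\<^bsub>arrays\<^esub> C)"
proof (rule arrays_eqI)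
  fix i l assume i: "i \<in> {1..n}" and l: "l \<in> {1..n}"
  interpret E: abelian_group "M i l" by (rule entry_abelian_group[OF i l])
  note a = array_entry[OF A] and b = array_entry[OF B] and c = array_entry[OF C]
  let ?f = "\<lambda>j k. mul i j l (A (i, j)) (mul j k l (B (j, k)) (C (k, l)))"
  have f: "?f j k \<in> carrier (M i l)" if "j \<in> {1..n}" "k \<in> {1..n}" for j k
    using that i l by (intro mul_closed a b c)
  have "((A \<otimes>\<^bsub>arrays\<^esub> B) \<otimes>\<^bsub>arrays\<^esub> C) (i, l) = (\<Oplus>\<^bsub>M i l\<^esub>k\<in>{1..n}. \<Oplus>\<^bsub>M i l\<^esub>j\<in>{1..n}. ?f j k)"
    unfolding arrays_mult_apply[OF i l]
  proof (rule E.finsum_cong')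
    fix k assume k: "k \<in> {1..n}"
    interpret h: abelian_group_hom "M i k" "M i l" "\<lambda>x. mul i k l x (C (k, l))"
      by (intro mul_hom_left i k l c)
    have "mul i k l ((A \<otimes>\<^bsub>arrays\<^esub> B) (i, k)) (C (k, l)) =
        (\<Oplus>\<^bsub>M i l\<^esub>j\<in>{1..n}. mul i k l (mul i j k (A (i, j)) (B (j, k))) (C (k, l)))"
      unfolding arrays_mult_apply[OF i k]
      by (rule h.hom_finsum) (intro Pi_I mul_closed i k a b)
    also have "\<dots> = (\<Oplus>\<^bsub>M i l\<^esub>j\<in>{1..n}. ?f j k)"
      by (rule E.finsum_cong')
        (auto simp only: intro!: f k entry_mult_assoc i l a b c Pi_I)
    finally show "mul i k l ((A \<otimes>\<^bsub>arrays\<^esub> B) (i, k)) (C (k, l)) = (\<Oplus>\<^bsub>M i l\<^esub>j\<in>{1..n}. ?f j k)" .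
  qed (auto intro!: E.finsum_closed f)
  also have "\<dots> = (\<Oplus>\<^bsub>M i l\<^esub>j\<in>{1..n}. \<Oplus>\<^bsub>M i l\<^esub>k\<in>{1..n}. ?f j k)"
    by (rule E.finsum_swap) (auto intro!: f)
  also have "\<dots> = (A \<otimes>\<^bsub>arrays\<^esub> (B \<otimes>\<^bsub>arrays\<^esub> C)) (i, l)"
    unfolding arrays_mult_apply[OF i l]
  proof (rule E.finsum_cong')
    fix j assume j: "j \<in> {1..n}"
    interpret h: abelian_group_hom "M j l" "M i l" "mul i j l (A (i, j))"
      by (intro mul_hom_right i j l a)
    show "(\<Oplus>\<^bsub>M i l\<^esub>k\<in>{1..n}. ?f j k) = mul i j l (A (i, j)) ((B \<otimes>\<^bsub>arrays\<^esub> C) (j, l))"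
      unfolding arrays_mult_apply[OF j l]
      by (rule h.hom_finsum[symmetric]) (intro Pi_I mul_closed j l b c)
  qed (auto simp only: intro!: mul_closed[OF i _ l] i l a array_entry[OF arrays_mult_closed[OF B C]] Pi_I)
  finally show "((A \<otimes>\<^bsub>arrays\<^esub> B) \<otimes>\<^bsub>arrays\<^esub> C) (i, l) = (A \<otimes>\<^bsub>arrays\<^esub> (B \<otimes>\<^bsub>arrays\<^esub> C)) (i, l)" .
qed (intro arrays_mult_closed A B C)+

lemma arrays_distrib_right:
  assumes A: "A \<in> carrier arrays" and B: "B \<in> carrier arrays" and C: "C \<in> carrier arrays"
  shows "(A \<oplus>\<^bsub>arrays\<^esub> B) \<otimes>\<^bsub>arrays\<^esub> C = A \<otimes>\<^bsub>arrays\<^esub> C \<oplus>\<^bsub>arrays\<^esub> B \<otimes>\<^bsub>arrays\<^esub> C"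
proof (rule arrays_eqI)
  fix i l assume i: "i \<in> {1..n}" and l: "l \<in> {1..n}"
  interpret E: abelian_group "M i l" by (rule entry_abelian_group[OF i l])
  note cl = mul_closed[OF i _ l] array_entry[OF A] array_entry[OF B] array_entry[OF C]
  have "((A \<oplus>\<^bsub>arrays\<^esub> B) \<otimes>\<^bsub>arrays\<^esub> C) (i, l) =
      (\<Oplus>\<^bsub>M i l\<^esub>j\<in>{1..n}. mul i j l (A (i, j)) (C (j, l)) \<oplus>\<^bsub>M i l\<^esub> mul i j l (B (i, j)) (C (j, l)))"
    unfolding arrays_mult_apply[OF i l]
    by (rule E.finsum_cong')
      (auto simp only: arrays_add_apply[OF i] intro!: E.a_closed cl mul_add_left i l Pi_I)
  also have "\<dots> = (A \<otimes>\<^bsub>arrays\<^esub> C \<oplus>\<^bsub>arrays\<^esub> B \<otimes>\<^bsub>arrays\<^esub> C) (i, l)"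
    unfolding arrays_mult_apply[OF i l] arrays_add_apply[OF i l]
    by (rule E.finsum_addf) (auto simp only: intro!: cl i l Pi_I)
  finally show "((A \<oplus>\<^bsub>arrays\<^esub> B) \<otimes>\<^bsub>arrays\<^esub> C) (i, l) =
      (A \<otimes>\<^bsub>arrays\<^esub> C \<oplus>\<^bsub>arrays\<^esub> B \<otimes>\<^bsub>arrays\<^esub> C) (i, l)" .
qed (intro arrays_mult_closed arrays_add_closed A B C)+

lemma arrays_distrib_left:
  assumes A: "A \<in> carrier arrays" and B: "B \<in> carrier arrays" and C: "C \<in> carrier arrays"
  shows "C \<otimes>\<^bsub>arrays\<^esub> (A \<oplus>\<^bsub>arrays\<^esub> B) = C \<otimes>\<^bsub>arrays\<^esub> A \<oplus>\<^bsub>arrays\<^esub> C \<otimes>\<^bsub>arrays\<^esub> B"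
proof (rule arrays_eqI)
  fix i l assume i: "i \<in> {1..n}" and l: "l \<in> {1..n}"
  interpret E: abelian_group "M i l" by (rule entry_abelian_group[OF i l])
  note cl = mul_closed[OF i _ l] array_entry[OF A] array_entry[OF B] array_entry[OF C]
  have "(C \<otimes>\<^bsub>arrays\<^esub> (A \<oplus>\<^bsub>arrays\<^esub> B)) (i, l) =
      (\<Oplus>\<^bsub>M i l\<^esub>j\<in>{1..n}. mul i j l (C (i, j)) (A (j, l)) \<oplus>\<^bsub>M i l\<^esub> mul i j l (C (i, j)) (B (j, l)))"
    unfolding arrays_mult_apply[OF i l]
    by (rule E.finsum_cong')
      (auto simp only: arrays_add_apply[OF _ l] intro!: E.a_closed cl mul_add_right i l Pi_I)
  also have "\<dots> = (C \<otimes>\<^bsub>arrays\<^esub> A \<oplus>\<^bsub>arrays\<^esub> C \<otimes>\<^bsub>arrays\<^esub> B) (i, l)"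
    unfolding arrays_mult_apply[OF i l] arrays_add_apply[OF i l]
    by (rule E.finsum_addf) (auto simp only: intro!: cl i l Pi_I)
  finally show "(C \<otimes>\<^bsub>arrays\<^esub> (A \<oplus>\<^bsub>arrays\<^esub> B)) (i, l) =
      (C \<otimes>\<^bsub>arrays\<^esub> A \<oplus>\<^bsub>arrays\<^esub> C \<otimes>\<^bsub>arrays\<^esub> B) (i, l)" .
qed (intro arrays_mult_closed arrays_add_closed A B C)+

lemma arrays_nonunital_ring: "nonunital_ring arrays"
  by (intro nonunital_ring.intro nonunital_ring_axioms.intro arrays_abelian_group
      arrays_mult_closed arrays_mult_assoc arrays_distrib_right arrays_distrib_left)


section \<open>Arrays with entries in prescribed subgroups\<close>

text \<open>
  Each summand of an entry of \<open>XA\<close> or \<open>AX\<close> lies in the prescribed subgroup of that entry, and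
  subgroups are closed under finite sums.
\<close>

lemma entrywise_ideal:
  assumes sub: "\<And>j k. \<lbrakk>j \<in> {1..n}; k \<in> {1..n}\<rbrakk> \<Longrightarrow> additive_subgroup (N j k) (M j k)"
    and left: "\<And>i j k x y. \<lbrakk>i \<in> {1..n}; j \<in> {1..n}; k \<in> {1..n}; x \<in> carrier (M i j); y \<in> N j k\<rbrakk>
      \<Longrightarrow> mul i j k x y \<in> N i k"
    and right: "\<And>i j k x y. \<lbrakk>i \<in> {1..n}; j \<in> {1..n}; k \<in> {1..n}; x \<in> N i j; y \<in> carrier (M j k)\<rbrakk>
      \<Longrightarrow> mul i j k x y \<in> N i k"
  shows "nonunital_ideal {A \<in> carrier arrays. \<forall>j\<in>{1..n}. \<forall>k\<in>{1..n}. A (j, k) \<in> N j k} arrays"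
    (is "nonunital_ideal ?I _")
proof -
  interpret nonunital_ring arrays by (rule arrays_nonunital_ring)
  have finsum_N: "(\<Oplus>\<^bsub>M i k\<^esub>j\<in>{1..n}. f j) \<in> N i k"
    if "i \<in> {1..n}" "k \<in> {1..n}" "\<And>j. j \<in> {1..n} \<Longrightarrow> f j \<in> N i k" for i k f
    using that
    by (intro abelian_group.finsum_in_additive_subgroup[OF entry_abelian_group] sub)
  show ?thesis
  proof (intro nonunital_ideal.intro nonunital_ideal_axioms.intro additive_subgroupI
      nonunital_ring_axioms add.subgroupI)
    show "?I \<subseteq> carrier arrays"
      by blast
    have "\<zero>\<^bsub>arrays\<^esub> \<in> ?I"
      by (auto simp: arrays_apply intro!: additive_subgroup.zero_closed sub)
    then show "?I \<noteq> {}"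
      by blast
  next
    fix A assume A: "A \<in> ?I"
    then have "array_minus A = \<ominus>\<^bsub>arrays\<^esub> A"
      using array_minus_add array_minus_closed by (auto intro!: minus_equality[symmetric])
    moreover have "array_minus A (j, k) \<in> N j k" if "j \<in> {1..n}" "k \<in> {1..n}" for j k
      using additive_subgroup.a_inv_closed[OF sub[OF that]] A that
      by (simp add: array_minus_def)
    then have "array_minus A \<in> ?I"
      using A array_minus_closed by blast
    ultimately show "\<ominus>\<^bsub>arrays\<^esub> A \<in> ?I"
      by simp
  next
    fix A B assume "A \<in> ?I" "B \<in> ?I"
    then show "A \<oplus>\<^bsub>arrays\<^esub> B \<in> ?I"
      by (auto simp: arrays_apply intro!: additive_subgroup.a_closed sub)
  next
    fix A X assume "A \<in> ?I" "X \<in> carrier arrays"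
    then show "X \<otimes>\<^bsub>arrays\<^esub> A \<in> ?I"
      by (auto simp only: arrays_apply intro!: mult_closed finsum_N left array_entry)
  next
    fix A X assume "A \<in> ?I" "X \<in> carrier arrays"
    then show "A \<otimes>\<^bsub>arrays\<^esub> X \<in> ?I"
      by (auto simp only: arrays_apply intro!: mult_closed finsum_N right array_entry)
  qed
qed


section \<open>The subgroups \<open>I\<^sub>j M\<^sub>j\<^sub>k\<close> and \<open>M\<^sub>j\<^sub>k I\<^sub>k\<close>\<close>

lemma product_generators_carrier:
  assumes "i \<in> {1..n}" "j \<in> {1..n}" "k \<in> {1..n}" "X \<subseteq> carrier (M i j)" "Y \<subseteq> carrier (M j k)"
  shows "{mul i j k x y | x y. x \<in> X \<and> y \<in> Y} \<subseteq> carrier (M i k)"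
  using assms by (auto intro!: mul_closed)

lemma product_subgroup_additive_subgroup:
  assumes "i \<in> {1..n}" "j \<in> {1..n}" "k \<in> {1..n}" "X \<subseteq> carrier (M i j)" "Y \<subseteq> carrier (M j k)"
  shows "additive_subgroup (product_subgroup R M \<theta> i j k X Y) (M i k)"
  unfolding product_subgroup_def
  using abelian_group.a_group[OF entry_abelian_group[OF assms(1,3)]]
    product_generators_carrier[OF assms]
  by (intro additive_subgroupI group.generate_is_subgroup) auto

lemma product_subgroup_mem:
  "\<lbrakk>x \<in> X; y \<in> Y\<rbrakk> \<Longrightarrow> mul i j k x y \<in> product_subgroup R M \<theta> i j k X Y"
  unfolding product_subgroup_def by (rule generate.incl) blast

text \<open>
  Associativity moves a left factor into the full first factor:
  \<open>a (x y) = (a x) y\<close> with \<open>a x \<in> M\<^sub>i\<^sub>k\<close>.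
\<close>

lemma mul_product_subgroup_left:
  assumes ijkl: "i \<in> {1..n}" "j \<in> {1..n}" "k \<in> {1..n}" "l \<in> {1..n}"
    and Y: "Y \<subseteq> carrier (M k l)" and a: "a \<in> carrier (M i j)"
    and b: "b \<in> product_subgroup R M \<theta> j k l (carrier (M j k)) Y"
  shows "mul i j l a b \<in> product_subgroup R M \<theta> i k l (carrier (M i k)) Y"
proof -
  interpret h: abelian_group_hom "M j l" "M i l" "mul i j l a"
    using ijkl a by (intro mul_hom_right)
  show ?thesis
  proof (rule h.hom_generate_subset)
    show "{mul j k l x y | x y. x \<in> carrier (M j k) \<and> y \<in> Y} \<subseteq> carrier (M j l)"
      using ijkl Y by (intro product_generators_carrier) auto
    show "b \<in> generate (add_monoid (M j l)) {mul j k l x y | x y. x \<in> carrier (M j k) \<and> y \<in> Y}"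
      using b by (simp add: product_subgroup_def)
  next
    fix s assume "s \<in> {mul j k l x y | x y. x \<in> carrier (M j k) \<and> y \<in> Y}"
    then obtain x y where s: "s = mul j k l x y" "x \<in> carrier (M j k)" "y \<in> Y"
      by blast
    then have "mul i j l a s = mul i k l (mul i j k a x) y"
      using entry_mult_assoc[OF ijkl a] Y by auto
    with s ijkl a show "mul i j l a s \<in> product_subgroup R M \<theta> i k l (carrier (M i k)) Y"
      by (auto intro!: product_subgroup_mem mul_closed)
  qed (use ijkl Y in \<open>intro product_subgroup_additive_subgroup order_refl\<close>)
qed

text \<open>The mirror image: \<open>(x y) b = x (y b)\<close> with \<open>y b \<in> M\<^sub>j\<^sub>l\<close>.\<close>

lemma mul_product_subgroup_right:
  assumes ijkl: "i \<in> {1..n}" "j \<in> {1..n}" "k \<in> {1..n}" "l \<in> {1..n}"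
    and X: "X \<subseteq> carrier (M i j)" and b: "b \<in> carrier (M k l)"
    and a: "a \<in> product_subgroup R M \<theta> i j k X (carrier (M j k))"
  shows "mul i k l a b \<in> product_subgroup R M \<theta> i j l X (carrier (M j l))"
proof -
  interpret h: abelian_group_hom "M i k" "M i l" "\<lambda>a. mul i k l a b"
    using ijkl b by (intro mul_hom_left)
  show ?thesis
  proof (rule h.hom_generate_subset)
    show "{mul i j k x y | x y. x \<in> X \<and> y \<in> carrier (M j k)} \<subseteq> carrier (M i k)"
      using ijkl X by (intro product_generators_carrier) auto
    show "a \<in> generate (add_monoid (M i k)) {mul i j k x y | x y. x \<in> X \<and> y \<in> carrier (M j k)}"
      using a by (simp add: product_subgroup_def)
  next
    fix s assume "s \<in> {mul i j k x y | x y. x \<in> X \<and> y \<in> carrier (M j k)}"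
    then obtain x y where s: "s = mul i j k x y" "x \<in> X" "y \<in> carrier (M j k)"
      by blast
    then have "mul i k l s b = mul i j l x (mul j k l y b)"
      using entry_mult_assoc[OF ijkl _ _ b] X by auto
    with s ijkl b show "mul i k l s b \<in> product_subgroup R M \<theta> i j l X (carrier (M j l))"
      by (auto intro!: product_subgroup_mem mul_closed)
  qed (use ijkl X in \<open>intro product_subgroup_additive_subgroup order_refl\<close>)
qed

text \<open>
  By symmetry \<open>I\<^sub>j\<^sub>k\<close> is the sum of a subgroup with itself, hence that subgroup.
\<close>

lemma ideal_entry_symmetric:
  assumes jk: "j \<in> {1..n}" "k \<in> {1..n}" and "\<I> j \<subseteq> carrier (R j)"
    and sym: "family_symmetric_entry R M \<theta> \<I> j k"
  shows "ideal_entry R M \<theta> \<I> j k = product_subgroup R M \<theta> j j k (\<I> j) (carrier (M j k))"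
    and "ideal_entry R M \<theta> \<I> j k = product_subgroup R M \<theta> j k k (carrier (M j k)) (\<I> k)"
proof -
  let ?P = "product_subgroup R M \<theta> j j k (\<I> j) (carrier (M j k))"
  have eq: "product_subgroup R M \<theta> j k k (carrier (M j k)) (\<I> k) = ?P"
    using sym by (simp add: family_symmetric_entry_def)
  have "additive_subgroup ?P (M j k)"
    using assms by (intro product_subgroup_additive_subgroup) (auto simp: carrier_diagonal)
  then have "?P <+>\<^bsub>M j k\<^esub> ?P = ?P"
    using group.subgroup_mult_id[OF abelian_group.a_group[OF entry_abelian_group[OF jk]]]
    by (simp add: set_add_def additive_subgroup.a_subgroup)
  then show "ideal_entry R M \<theta> \<I> j k = ?P"
    and "ideal_entry R M \<theta> \<I> j k = product_subgroup R M \<theta> j k k (carrier (M j k)) (\<I> k)"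
    by (simp_all add: ideal_entry_def eq)
qed

end


section \<open>The ideal of a symmetric family\<close>

theorem corollary3p8:
  fixes n :: nat
    and R :: "nat \<Rightarrow> 'a ring"
    and M :: "nat \<Rightarrow> nat \<Rightarrow> ('a, 'a, 'a) bimodule"
    and \<theta> :: "nat \<Rightarrow> nat \<Rightarrow> nat \<Rightarrow> ('a \<times> 'a \<Rightarrow>\<^sub>0 int) set \<Rightarrow> 'a"
    and \<I> :: "nat \<Rightarrow> 'a set"
  assumes "n \<ge> 1"
    and "generalized_matrix_ring n R M \<theta>"
    and "\<And>j. j \<in> {1..n} \<Longrightarrow> nonunital_ideal (\<I> j) (R j)"
    and "family_symmetric n R M \<theta> \<I>"
  shows "nonunital_ideal (ideal_arrays n R M \<theta> \<I>) (matrix_ring n R M \<theta>)"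
proof -
  interpret generalized_matrix_ring n R M \<theta> by fact
  have I_sub: "\<I> j \<subseteq> carrier (R j)" "\<I> j \<subseteq> carrier (M j j)" if "j \<in> {1..n}" for j
    using additive_subgroup.a_subset[OF nonunital_ideal.axioms(1)[OF assms(3)[OF that]]] that
    by (simp_all add: carrier_diagonal)
  have IM: "ideal_entry R M \<theta> \<I> j k = product_subgroup R M \<theta> j j k (\<I> j) (carrier (M j k))"
    and MI: "ideal_entry R M \<theta> \<I> j k = product_subgroup R M \<theta> j k k (carrier (M j k)) (\<I> k)"
    if "j \<in> {1..n}" "k \<in> {1..n}" for j k
    using ideal_entry_symmetric[where \<I> = \<I>, OF that I_sub(1)[OF that(1)]] assms(4) that
    by (simp_all add: family_symmetric_def)
  show ?thesis
    unfolding ideal_arrays_def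
  proof (rule entrywise_ideal)
    fix j k assume "j \<in> {1..n}" "k \<in> {1..n}"
    then show "additive_subgroup (ideal_entry R M \<theta> \<I> j k) (M j k)"
      using I_sub by (simp only: IM) (intro product_subgroup_additive_subgroup order_refl)
  next
    fix i j k x y
    assume ijk: "i \<in> {1..n}" "j \<in> {1..n}" "k \<in> {1..n}"
      and "x \<in> carrier (M i j)" "y \<in> ideal_entry R M \<theta> \<I> j k"
    then show "mul i j k x y \<in> ideal_entry R M \<theta> \<I> i k"
      using mul_product_subgroup_left[OF ijk ijk(3)] I_sub by (simp only: MI)
  next
    fix i j k x y
    assume ijk: "i \<in> {1..n}" "j \<in> {1..n}" "k \<in> {1..n}"
      and "x \<in> ideal_entry R M \<theta> \<I> i j" "y \<in> carrier (M j k)"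
    then show "mul i j k x y \<in> ideal_entry R M \<theta> \<I> i k"
      using mul_product_subgroup_right[OF ijk(1) ijk] I_sub by (simp only: IM)
  qed
qed

end
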